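(* For any $\alpha\in(1/2,1)$ and $p>0$ there exist $A,B\in\mathbb{M}_2^{++}$ such that $LE_\alpha(A,B)\not\prec_{\log}\widetilde{SG}_{\alpha,p}(A,B)$.
   Context: Notation: $\mathbb{M}_2^{++}$ is the set of $2\times2$ complex positive definite matrices. For $A,B\in\mathbb{M}_2^{++}$ and $0<\alpha<1$, $p>0$: - $A\#_\alpha B:=A^{1/2}(A^{-1/2}BA^{-1/2})^{\alpha}A^{1/2}$; - $\widetilde{SG}_{\alpha,p}(A,B):=\bigl((A^{-p}\#_\alpha B^p)^{1/2}A^{2(1-\alpha)p}(A^{-p}\#_\alpha B^p)^{1/2}\bigr)^{1/p}$; - $LE_\alpha(A,B):=\exp((1-\alpha)\log A+\alpha\log B)$. Log-majorization: for positive semidefinite $n\times n$ matrices $X,Y$ with eigenvalues $\lambda_1(\cdot)\ge\dots\ge\lambda_n(\cdot)$ counted with multiplicity, $X\prec_{\log}Y$ means $\prod_{i=1}^k\lambda_i(X)\le\prod_{i=1}^k\lambda_i(Y)$ for $1\le k\le n$, with equality for $k=n$. *)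

theory Defs
  imports "HOL-Analysis.Analysis" "Jordan_Normal_Form.Schur_Decomposition"
begin

definition pos_def_mats :: "nat \<Rightarrow> complex mat set" where
  "pos_def_mats n = {A \<in> carrier_mat n n. mat_adjoint A = A \<and>
     (\<forall>v \<in> carrier_vec n. v \<noteq> 0\<^sub>v n \<longrightarrow> 0 < Re ((A *\<^sub>v v) \<bullet>c v))}"

definition unitary_mats :: "nat \<Rightarrow> complex mat set" where
  "unitary_mats n = {U \<in> carrier_mat n n. mat_adjoint U * U = 1\<^sub>m n}"

definition spectral_form :: "complex mat \<Rightarrow> (nat \<Rightarrow> real) \<Rightarrow> complex mat" where
  "spectral_form U d =
     U * mat_diag (dim_row U) (\<lambda>i. complex_of_real (d i)) * mat_adjoint U"

text \<open>Functional calculus of a Hermitian matrix: \<open>f (U diag(d) U\<^sup>*) = U diag(f \<circ> d) U\<^sup>*\<close>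
  for unitary \<open>U\<close> and real \<open>d\<close>. The result does not depend on the chosen diagonalization
  (lemma \<open>mat_fun_spectral_form\<close> below); it is unspecified for non-Hermitian matrices.\<close>

definition mat_fun :: "(real \<Rightarrow> real) \<Rightarrow> complex mat \<Rightarrow> complex mat" where
  "mat_fun f A = (THE X. \<exists>U \<in> unitary_mats (dim_row A). \<exists>d.
     A = spectral_form U d \<and> X = spectral_form U (\<lambda>i. f (d i)))"

definition mat_powr :: "complex mat \<Rightarrow> real \<Rightarrow> complex mat" where
  "mat_powr A r = mat_fun (\<lambda>x. x powr r) A"

definition mat_ln :: "complex mat \<Rightarrow> complex mat" where
  "mat_ln A = mat_fun ln A"

definition mat_exp :: "complex mat \<Rightarrow> complex mat" where
  "mat_exp A = mat_fun exp A"

definition geo_mean :: "real \<Rightarrow> complex mat \<Rightarrow> complex mat \<Rightarrow> complex mat" where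
  "geo_mean \<alpha> A B = mat_powr A (1/2) *
     mat_powr (mat_powr A (-1/2) * B * mat_powr A (-1/2)) \<alpha> * mat_powr A (1/2)"

definition SG_tilde :: "real \<Rightarrow> real \<Rightarrow> complex mat \<Rightarrow> complex mat \<Rightarrow> complex mat" where
  "SG_tilde \<alpha> p A B =
     (let G = geo_mean \<alpha> (mat_powr A (-p)) (mat_powr B p)
      in mat_powr (mat_powr G (1/2) * mat_powr A (2 * (1 - \<alpha>) * p) * mat_powr G (1/2)) (1/p))"

definition LE_mean :: "real \<Rightarrow> complex mat \<Rightarrow> complex mat \<Rightarrow> complex mat" where
  "LE_mean \<alpha> A B = mat_exp (complex_of_real (1 - \<alpha>) \<cdot>\<^sub>m mat_ln A + complex_of_real \<alpha> \<cdot>\<^sub>m mat_ln B)"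

text \<open>Eigenvalues in decreasing order, repeated according to their multiplicity as roots of the
  characteristic polynomial. Meant for Hermitian matrices, where all these roots are real and
  taking real parts loses nothing.\<close>

definition eigvals_desc :: "complex mat \<Rightarrow> real list" where
  "eigvals_desc X = rev (sorted_list_of_multiset (image_mset Re (proots (char_poly X))))"

text \<open>List positions start at 0, so \<open>\<lambda>\<^sub>i(X)\<close> is \<open>eigvals_desc X ! (i - 1)\<close>.\<close>

definition log_maj :: "nat \<Rightarrow> complex mat \<Rightarrow> complex mat \<Rightarrow> bool" where
  "log_maj n X Y \<longleftrightarrow>
     (\<forall>k \<in> {1..n}. (\<Prod>i=1..k. eigvals_desc X ! (i - 1)) \<le> (\<Prod>i=1..k. eigvals_desc Y ! (i - 1))) \<and>
     (\<Prod>i=1..n. eigvals_desc X ! (i - 1)) = (\<Prod>i=1..n. eigvals_desc Y ! (i - 1))"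

lemma mat_adjoint_carrier [simp]: "A \<in> carrier_mat m n \<Longrightarrow> mat_adjoint A \<in> carrier_mat n m"
  unfolding mat_adjoint_def by (rule carrier_matI) simp_all

lemma unitary_matsD:
  assumes "U \<in> unitary_mats n"
  shows "U \<in> carrier_mat n n" "mat_adjoint U * U = 1\<^sub>m n" "U * mat_adjoint U = 1\<^sub>m n"
proof -
  show U: "U \<in> carrier_mat n n" and l: "mat_adjoint U * U = 1\<^sub>m n"
    using assms by (auto simp: unitary_mats_def)
  show "U * mat_adjoint U = 1\<^sub>m n"
    using mat_mult_left_right_inverse[OF mat_adjoint_carrier[OF U] U l] .
qed

lemma spectral_form_unique:
  assumes U: "U \<in> unitary_mats n" and V: "V \<in> unitary_mats n"
    and eq: "spectral_form U d = spectral_form V e"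
  shows "spectral_form U (\<lambda>i. f (d i)) = spectral_form V (\<lambda>i. f (e i))"
proof -
  note u = unitary_matsD[OF U] and v = unitary_matsD[OF V]
  let ?D = "\<lambda>g. mat_diag n (\<lambda>i. complex_of_real (g i))"
  have c [simp]: "?D g \<in> carrier_mat n n" for g :: "nat \<Rightarrow> real" by (simp add: mat_diag_def)
  note [simp] = u(1) v(1) mat_adjoint_carrier[OF u(1)] mat_adjoint_carrier[OF v(1)]
  have [simp]: "A * B \<in> carrier_mat n n"
    if "A \<in> carrier_mat n n" "B \<in> carrier_mat n n" for A B :: "complex mat"
    using that by (rule mult_carrier_mat)
  note assoc = assoc_mult_mat[of _ n n _ n _ n]
  define W where "W = mat_adjoint V * U"
  have W: "W \<in> carrier_mat n n" by (simp add: W_def)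
  have sf: "spectral_form U g = U * ?D g * mat_adjoint U"
    "spectral_form V g = V * ?D g * mat_adjoint V" for g
    unfolding spectral_form_def carrier_matD(1)[OF u(1)] carrier_matD(1)[OF v(1)] by (rule refl)+
  have red: "spectral_form U g = spectral_form V h \<longleftrightarrow> W * ?D g = ?D h * W" for g h
  proof
    assume "spectral_form U g = spectral_form V h"
    then have "mat_adjoint V * (U * ?D g * mat_adjoint U) * U
        = mat_adjoint V * (V * ?D h * mat_adjoint V) * U"
      by (simp add: sf)
    moreover have "mat_adjoint V * (U * ?D g * mat_adjoint U) * U
        = mat_adjoint V * U * ?D g * (mat_adjoint U * U)"
      by (simp add: assoc)
    moreover have "mat_adjoint V * (V * ?D h * mat_adjoint V) * U
        = (mat_adjoint V * V) * ?D h * (mat_adjoint V * U)"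
      by (simp add: assoc)
    ultimately show "W * ?D g = ?D h * W"
      using W by (simp add: u v W_def left_mult_one_mat[of _ n n] right_mult_one_mat[of _ n n])
  next
    assume a: "W * ?D g = ?D h * W"
    have "spectral_form U g = (V * mat_adjoint V) * U * ?D g * mat_adjoint U"
      by (simp add: sf v left_mult_one_mat[of _ n n])
    also have "\<dots> = V * (W * ?D g) * mat_adjoint U"
      by (simp add: W_def assoc)
    also have "\<dots> = V * ?D h * mat_adjoint V * (U * mat_adjoint U)"
      unfolding a by (simp add: W_def assoc)
    also have "\<dots> = spectral_form V h"
      by (simp add: sf u right_mult_one_mat[of _ n n])
    finally show "spectral_form U g = spectral_form V h" .
  qed
  have entries: "W * ?D g = ?D h * W \<longleftrightarrow>
      (\<forall>i<n. \<forall>j<n. W $$ (i,j) * complex_of_real (g j) = complex_of_real (h i) * W $$ (i,j))" for g h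
    unfolding mat_diag_mult_left[OF W] mat_diag_mult_right[OF W]
    by (auto simp: mat_eq_iff)
  have "W * ?D d = ?D e * W" using eq red by blast
  then have *: "W $$ (i,j) = 0 \<or> d j = e i" if "i < n" "j < n" for i j
    using that unfolding entries by (auto simp: mult.commute)
  have "W * ?D (\<lambda>i. f (d i)) = ?D (\<lambda>i. f (e i)) * W"
    unfolding entries
  proof (intro allI impI)
    fix i j assume "i < n" "j < n"
    from *[OF this] show "W $$ (i,j) * complex_of_real (f (d j)) = complex_of_real (f (e i)) * W $$ (i,j)"
      by auto
  qed
  then show ?thesis using red by blast
qed

lemma mat_fun_spectral_form:
  assumes U: "U \<in> unitary_mats n"
  shows "mat_fun f (spectral_form U d) = spectral_form U (\<lambda>i. f (d i))"
proof -
  have dim: "dim_row (spectral_form U d) = n"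
    using unitary_matsD(1)[OF U] by (simp add: spectral_form_def)
  show ?thesis
    unfolding mat_fun_def dim
  proof (rule the_equality)
    show "\<exists>V \<in> unitary_mats n. \<exists>e. spectral_form U d = spectral_form V e \<and>
        spectral_form U (\<lambda>i. f (d i)) = spectral_form V (\<lambda>i. f (e i))"
      using U by blast
  next
    fix X assume "\<exists>V \<in> unitary_mats n. \<exists>e. spectral_form U d = spectral_form V e \<and>
        X = spectral_form V (\<lambda>i. f (e i))"
    then obtain V e where V: "V \<in> unitary_mats n" "spectral_form U d = spectral_form V e"
      and X: "X = spectral_form V (\<lambda>i. f (e i))" by blast
    show "X = spectral_form U (\<lambda>i. f (d i))"
      unfolding X by (rule spectral_form_unique[OF U V, symmetric])
  qed
qed

end

theory Submission
  imports Defs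
begin

text \<open>Replacing \<open>A, B\<close> by their powers reduces everything to \<open>p = 1\<close>. Put
  \<open>C = A\<^bsup>1/2\<^esup> B A\<^bsup>1/2\<^esup>\<close>; then \<open>\<lambda>\<^sub>1(SG) \<le> tr (A\<^bsup>1-2\<alpha>\<^esup> C\<^bsup>\<alpha>\<^esup>)\<close>. For \<open>A = diag(t\<^sup>2, 1)\<close> with \<open>t\<close> large
  and \<open>C\<close> with eigenvalue \<open>1\<close> and small eigenvalue \<open>\<epsilon>\<close> and eigenvectors at angle \<open>\<pi>/4\<close> to the axes, this trace is
  close to \<open>1/2\<close>, because \<open>1 - 2\<alpha> < 0\<close>. On the other hand \<open>log A \<ge> 0\<close>, so the Rayleigh quotient
  of \<open>(1-\<alpha>) log A + \<alpha> log B\<close> at the top eigenvector of \<open>B\<close> gives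
  \<open>\<lambda>\<^sub>1(LE) \<ge> \<lambda>\<^sub>1(B)\<^bsup>\<alpha>\<^esup> \<ge> B\<^sub>2\<^sub>2\<^bsup>\<alpha>\<^esup> \<ge> 2\<^bsup>-\<alpha>\<^esup> > 1/2\<close>.\<close>

section \<open>Eigenvalues of a matrix in spectral form\<close>

lemma char_poly_spectral_form:
  assumes U: "U \<in> unitary_mats n"
  shows "char_poly (spectral_form U d) = (\<Prod>i\<leftarrow>[0..<n]. [:- complex_of_real (d i), 1:])"
proof -
  note u = unitary_matsD[OF U]
  let ?D = "mat_diag n (\<lambda>i. complex_of_real (d i))"
  have D: "?D \<in> carrier_mat n n" by (simp add: mat_diag_def)
  have sf: "spectral_form U d = U * ?D * mat_adjoint U"
    unfolding spectral_form_def carrier_matD(1)[OF u(1)] ..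
  have "similar_mat_wit (spectral_form U d) ?D U (mat_adjoint U)"
    unfolding similar_mat_wit_def Let_def sf using u D by (auto intro!: mult_carrier_mat[of _ n n])
  then have "char_poly (spectral_form U d) = char_poly ?D"
    by (intro char_poly_similar) (auto simp: similar_mat_def)
  also have "\<dots> = (\<Prod>a\<leftarrow>diag_mat ?D. [:- a, 1:])"
    by (rule char_poly_upper_triangular[OF D]) (auto simp: upper_triangular_def mat_diag_def)
  also have "diag_mat ?D = map (\<lambda>i. complex_of_real (d i)) [0..<n]"
    by (auto simp: diag_mat_def mat_diag_def)
  finally show ?thesis by (simp add: comp_def)
qed

lemma eigvals_desc_spectral_form:
  assumes "U \<in> unitary_mats n"
  shows "eigvals_desc (spectral_form U d) = rev (sort (map d [0..<n]))"
proof -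
  have "proots (\<Prod>i\<leftarrow>xs. [:- complex_of_real (d i), 1:])
      = mset (map (\<lambda>i. complex_of_real (d i)) xs)" for xs :: "nat list"
  proof (induction xs)
    case (Cons a xs)
    have "(\<Prod>i\<leftarrow>xs. [:- complex_of_real (d i), 1:]) \<noteq> 0"
      by (auto simp: prod_list_zero_iff)
    then show ?case using Cons by (simp add: proots_mult del: mult_pCons_left)
  qed simp
  then show ?thesis
    unfolding eigvals_desc_def char_poly_spectral_form[OF assms]
    by (simp add: image_mset.compositionality comp_def flip: mset_map)
qed

section \<open>Real symmetric 2x2 matrices and their functional calculus\<close>

definition sym2 :: "real \<Rightarrow> real \<Rightarrow> real \<Rightarrow> complex mat" where
  "sym2 x y z = mat 2 2 (\<lambda>(i, j). complex_of_real (if i \<noteq> j then y else if i = 0 then x else z))"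

lemma sym2_carrier [simp]: "sym2 x y z \<in> carrier_mat 2 2"
  by (simp add: sym2_def)

lemma nat_less_2_iff: "(i::nat) < 2 \<longleftrightarrow> i = 0 \<or> i = 1"
  by auto

lemma sym2_triple_product:
  "sym2 p q r * sym2 x y z * sym2 p q r
   = sym2 (p\<^sup>2 * x + 2 * p * q * y + q\<^sup>2 * z)
       (p * q * x + (p * r + q\<^sup>2) * y + q * r * z)
       (q\<^sup>2 * x + 2 * q * r * y + r\<^sup>2 * z)"
  by (rule eq_matI)
    (auto simp: sym2_def nat_less_2_iff scalar_prod_def numeral_2_eq_2 algebra_simps)

lemma sym2_linear_combination:
  "complex_of_real a \<cdot>\<^sub>m sym2 x y z + complex_of_real b \<cdot>\<^sub>m sym2 x' y' z'
   = sym2 (a * x + b * x') (a * y + b * y') (a * z + b * z')"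
  by (rule eq_matI) (auto simp: sym2_def)

definition rotation :: "real \<Rightarrow> complex mat" where
  "rotation \<theta> = mat 2 2 (\<lambda>(i, j). complex_of_real
     (if i = j then cos \<theta> else if i = 0 then - sin \<theta> else sin \<theta>))"

lemma mat_adjoint_rotation:
  "mat_adjoint (rotation \<theta>) = mat 2 2 (\<lambda>(i, j). complex_of_real
     (if i = j then cos \<theta> else if i = 0 then sin \<theta> else - sin \<theta>))"
  by (rule eq_matI) (auto simp: rotation_def mat_adjoint_def mat_of_rows_def)

lemma rotation_unitary: "rotation \<theta> \<in> unitary_mats 2"
proof -
  define c s where "c = cos \<theta>" and "s = sin \<theta>"
  have "c * c + s * s = 1"
    by (simp add: c_def s_def flip: power2_eq_square)
  then have "complex_of_real c * complex_of_real c + complex_of_real s * complex_of_real s = 1"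
    by (metis of_real_1 of_real_add of_real_mult)
  then have "mat_adjoint (rotation \<theta>) * rotation \<theta> = 1\<^sub>m 2"
    unfolding mat_adjoint_rotation unfolding rotation_def c_def[symmetric] s_def[symmetric]
    by (intro eq_matI) (auto simp: nat_less_2_iff scalar_prod_def numeral_2_eq_2 add.commute)
  then show ?thesis by (simp add: unitary_mats_def) (simp add: rotation_def)
qed

text \<open>The eigenvalue \<open>x\<close> belongs to the unit vector
  \<open>(cos \<theta>, sin \<theta>)\<close>, the eigenvalue \<open>y\<close> to
  \<open>(- sin \<theta>, cos \<theta>)\<close>.\<close>

definition rotated_diag :: "real \<Rightarrow> real \<Rightarrow> real \<Rightarrow> complex mat" where
  "rotated_diag \<theta> x y = spectral_form (rotation \<theta>) (\<lambda>i. if i = 0 then x else y)"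

lemma rotated_diag_eq_sym2:
  "rotated_diag \<theta> x y = sym2 (x * (cos \<theta>)\<^sup>2 + y * (sin \<theta>)\<^sup>2) ((x - y) * (cos \<theta> * sin \<theta>))
     (x * (sin \<theta>)\<^sup>2 + y * (cos \<theta>)\<^sup>2)"
  unfolding rotated_diag_def spectral_form_def mat_adjoint_rotation
  by (rule eq_matI)
    (auto simp: sym2_def rotation_def mat_diag_def nat_less_2_iff scalar_prod_def numeral_2_eq_2
      algebra_simps)

lemma sym2_diagonal: "sym2 x 0 z = rotated_diag 0 x z"
  by (simp add: rotated_diag_eq_sym2)

lemma mat_fun_rotated_diag: "mat_fun f (rotated_diag \<theta> x y) = rotated_diag \<theta> (f x) (f y)"
  unfolding rotated_diag_def mat_fun_spectral_form[OF rotation_unitary]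
  by (rule arg_cong[where f = "spectral_form (rotation \<theta>)"]) auto

lemma mat_fun_sym2_diagonal: "mat_fun f (sym2 x 0 z) = sym2 (f x) 0 (f z)"
  by (simp add: sym2_diagonal mat_fun_rotated_diag)

lemma eigvals_desc_rotated_diag: "eigvals_desc (rotated_diag \<theta> x y) ! 0 = max x y"
  unfolding rotated_diag_def eigvals_desc_spectral_form[OF rotation_unitary]
  by (auto simp: numeral_2_eq_2)

lemma sym2_inject: "sym2 x y z = sym2 x' y' z' \<longleftrightarrow> x = x' \<and> y = y' \<and> z = z'"
proof
  assume "sym2 x y z = sym2 x' y' z'"
  then have "sym2 x y z $$ (i, j) = sym2 x' y' z' $$ (i, j)" for i j by simp
  from this[of 0 0] this[of 0 1] this[of 1 1] show "x = x' \<and> y = y' \<and> z = z'"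
    by (simp add: sym2_def)
qed simp

text \<open>Trace and determinant are invariant under rotation, so the entries control the
  eigenvalues without solving the characteristic equation.\<close>

lemma rotated_diag_trace_det:
  assumes "rotated_diag \<theta> a b = sym2 x y z"
  shows "a + b = x + z" "a * b = x * z - y\<^sup>2"
proof -
  define c s where "c = cos \<theta>" and "s = sin \<theta>"
  have cs: "c\<^sup>2 + s\<^sup>2 = 1" by (simp add: c_def s_def)
  have e: "x = a * c\<^sup>2 + b * s\<^sup>2" "y = (a - b) * (c * s)" "z = a * s\<^sup>2 + b * c\<^sup>2"
    using assms unfolding rotated_diag_eq_sym2 sym2_inject c_def s_def by auto
  have "x + z = (a + b) * (c\<^sup>2 + s\<^sup>2)" by (simp add: e algebra_simps)
  then show "a + b = x + z" by (simp add: cs)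
  have "x * z - y\<^sup>2 = a * b * (c\<^sup>2 + s\<^sup>2)\<^sup>2"
    by (simp add: e algebra_simps power2_eq_square)
  then show "a * b = x * z - y\<^sup>2" by (simp add: cs)
qed

text \<open>The polar coordinates of \<open>((x - z)/2, y)\<close> are half the eigenvalue gap and the doubled angle.\<close>

lemma sym2_diagonalization:
  obtains \<theta> a b where "sym2 x y z = rotated_diag \<theta> a b" "b \<le> a"
proof -
  obtain r \<phi> where r: "0 \<le> r" "(x - z) / 2 = r * cos \<phi>" "y = r * sin \<phi>"
  proof -
    let ?w = "Complex ((x - z) / 2) y"
    have "?w = rcis (cmod ?w) (Arg ?w)" by (simp add: rcis_cmod_Arg)
    then have "(x - z) / 2 = cmod ?w * cos (Arg ?w)" "y = cmod ?w * sin (Arg ?w)"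
      by (metis Re_rcis complex.sel(1), metis Im_rcis complex.sel(2))
    then show ?thesis using that[of "cmod ?w" "Arg ?w"] by simp
  qed
  define c s where "c = cos (\<phi> / 2)" and "s = sin (\<phi> / 2)"
  have cs: "c\<^sup>2 + s\<^sup>2 = 1" by (simp add: c_def s_def)
  have d: "cos \<phi> = c\<^sup>2 - s\<^sup>2" "sin \<phi> = 2 * s * c"
    using cos_double[of "\<phi> / 2"] sin_double[of "\<phi> / 2"] by (simp_all add: c_def s_def)
  let ?m = "(x + z) / 2"
  have "(?m + r) * c\<^sup>2 + (?m - r) * s\<^sup>2 = ?m * (c\<^sup>2 + s\<^sup>2) + r * (c\<^sup>2 - s\<^sup>2)"
       "(?m + r) * s\<^sup>2 + (?m - r) * c\<^sup>2 = ?m * (c\<^sup>2 + s\<^sup>2) - r * (c\<^sup>2 - s\<^sup>2)"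
    by (simp_all add: algebra_simps)
  then have "sym2 x y z = rotated_diag (\<phi> / 2) (?m + r) (?m - r)"
    unfolding rotated_diag_eq_sym2 sym2_inject c_def[symmetric] s_def[symmetric]
    using r(2,3) by (simp add: cs d flip: d(1)) (simp add: field_simps)
  then show ?thesis using that r(1) by fastforce
qed

section \<open>Positivity and eigenvalue bounds\<close>

lemma mat_adjoint_sym2: "mat_adjoint (sym2 x y z) = sym2 x y z"
  by (rule eq_matI) (auto simp: sym2_def mat_adjoint_def mat_of_rows_def)

lemma rotated_diag_pos_def:
  assumes "0 < a" "0 < b"
  shows "rotated_diag \<theta> a b \<in> pos_def_mats 2"
proof -
  define c s where "c = cos \<theta>" and "s = sin \<theta>"
  have cs: "c\<^sup>2 + s\<^sup>2 = 1" by (simp add: c_def s_def)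
  have "0 < Re ((rotated_diag \<theta> a b *\<^sub>v v) \<bullet>c v)"
    if v: "v \<in> carrier_vec 2" "v \<noteq> 0\<^sub>v 2" for v
  proof -
    define p q where "p = v $ 0" and "q = v $ 1"
    \<comment> \<open>Up to the sign of \<open>w\<close>, these are the coordinates of
      \<open>v\<close> in the eigenbasis; the quadratic form becomes \<open>a\<close> times the
      squared modulus of \<open>u\<close> plus \<open>b\<close> times that of
      \<open>w\<close>.\<close>
    define u w where "u = c * p + s * q" and "w = s * p - c * q"
    have "Re ((rotated_diag \<theta> a b *\<^sub>v v) \<bullet>c v)
        = a * ((Re u)\<^sup>2 + (Im u)\<^sup>2) + b * ((Re w)\<^sup>2 + (Im w)\<^sup>2)"
      using v(1) unfolding rotated_diag_eq_sym2 c_def[symmetric] s_def[symmetric] u_def w_def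
      by (auto simp: sym2_def scalar_prod_def numeral_2_eq_2 p_def q_def algebra_simps power2_eq_square)
    moreover have "u \<noteq> 0 \<or> w \<noteq> 0"
    proof (rule ccontr)
      assume "\<not> (u \<noteq> 0 \<or> w \<noteq> 0)"
      moreover have "(complex_of_real c)\<^sup>2 + (complex_of_real s)\<^sup>2 = 1"
        using cs by (metis of_real_1 of_real_add of_real_power)
      \<comment> \<open>The map from \<open>(p, q)\<close> to \<open>(u, w)\<close> is a reflection,
        hence its own inverse.\<close>
      moreover have "c * u + s * w = ((complex_of_real c)\<^sup>2 + (complex_of_real s)\<^sup>2) * p"
        "s * u - c * w = ((complex_of_real c)\<^sup>2 + (complex_of_real s)\<^sup>2) * q"
        by (simp_all add: u_def w_def algebra_simps power2_eq_square)
      ultimately have "p = 0" "q = 0" by auto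
      then have "v = 0\<^sub>v 2" using v(1)
        by (intro eq_vecI) (auto simp: p_def q_def nat_less_2_iff)
      with v(2) show False ..
    qed
    then have "0 < (Re u)\<^sup>2 + (Im u)\<^sup>2 \<or> 0 < (Re w)\<^sup>2 + (Im w)\<^sup>2"
      by (auto simp: complex_eq_iff sum_power2_gt_zero_iff)
    ultimately show ?thesis
      using assms by (auto intro: add_pos_nonneg add_nonneg_pos)
  qed
  then show ?thesis
    by (simp add: pos_def_mats_def) (simp add: rotated_diag_eq_sym2 mat_adjoint_sym2)
qed

text \<open>In the eigenbasis the quadratic form at the unit vector \<open>(c, s)\<close> is a
  weighted mean of \<open>a\<close> and \<open>b\<close>: the weights are squares that sum to
  1.\<close>

lemma rayleigh_le_max_eigval:
  assumes "sym2 x y z = rotated_diag \<theta> a b" "c\<^sup>2 + s\<^sup>2 = 1"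
  shows "x * c\<^sup>2 + 2 * y * c * s + z * s\<^sup>2 \<le> max a b"
proof -
  define k l where "k = cos \<theta>" and "l = sin \<theta>"
  have kl: "k\<^sup>2 + l\<^sup>2 = 1" by (simp add: k_def l_def)
  have "x * c\<^sup>2 + 2 * y * c * s + z * s\<^sup>2 = a * (k * c + l * s)\<^sup>2 + b * (l * c - k * s)\<^sup>2"
  proof -
    have e: "x = a * k\<^sup>2 + b * l\<^sup>2" "y = (a - b) * (k * l)" "z = a * l\<^sup>2 + b * k\<^sup>2"
      using assms(1) unfolding rotated_diag_eq_sym2 sym2_inject k_def l_def by auto
    show ?thesis by (simp add: e algebra_simps power2_eq_square)
  qed
  also have "\<dots> \<le> max a b * (k * c + l * s)\<^sup>2 + max a b * (l * c - k * s)\<^sup>2"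
    by (intro add_mono mult_right_mono) auto
  also have "\<dots> = max a b * ((k\<^sup>2 + l\<^sup>2) * (c\<^sup>2 + s\<^sup>2))"
    by (simp add: algebra_simps power2_eq_square)
  finally show ?thesis by (simp add: kl assms(2))
qed

lemma rotated_diag_pos_eigvals:
  assumes "rotated_diag \<theta> a b = sym2 x y z" "0 \<le> x" "0 < z" "0 < x * z - y\<^sup>2"
  shows "0 < a" "0 < b"
proof -
  have "0 < a + b" "0 < a * b" using rotated_diag_trace_det[OF assms(1)] assms by auto
  then show "0 < a" "0 < b" by (auto simp: zero_less_mult_iff)
qed

text \<open>With \<open>G = sym2 x y z\<close> and \<open>K = diag(k, 1)\<close>, the product of
  \<open>G^(1/2)\<close>, \<open>K\<close>, \<open>G^(1/2)\<close> has trace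
  \<open>tr(K G) = k * x + z\<close>. Its eigenvalues are nonnegative, so each is at most the
  trace.\<close>

lemma eigval_powr_sandwich_le_trace:
  assumes G: "sym2 x y z = rotated_diag \<theta> a b" and "0 < a" "0 < b" "0 \<le> k" "0 < r"
  shows "eigvals_desc (mat_powr (mat_powr (sym2 x y z) (1/2) * sym2 k 0 1
    * mat_powr (sym2 x y z) (1/2)) r) ! 0 \<le> (k * x + z) powr r"
proof -
  obtain f g h where H: "rotated_diag \<theta> (sqrt a) (sqrt b) = sym2 f g h"
    by (metis rotated_diag_eq_sym2)
  have "mat_powr (sym2 x y z) (1/2) = sym2 f g h"
    using assms by (simp add: G mat_powr_def mat_fun_rotated_diag powr_half_sqrt H)
  \<comment> \<open>These are the diagonal entries of the identity saying that
    \<open>sym2 f g h\<close> squares to \<open>sym2 x y z\<close>.\<close>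
  moreover have xyz: "x = f\<^sup>2 + g\<^sup>2" "z = g\<^sup>2 + h\<^sup>2"
  proof -
    define c s u v where "c = cos \<theta>" and "s = sin \<theta>" and "u = sqrt a" and "v = sqrt b"
    have cs: "c\<^sup>2 + s\<^sup>2 = 1" by (simp add: c_def s_def)
    have ab: "a = u\<^sup>2" "b = v\<^sup>2" using assms by (auto simp: u_def v_def)
    have e: "f = u * c\<^sup>2 + v * s\<^sup>2" "g = (u - v) * (c * s)" "h = u * s\<^sup>2 + v * c\<^sup>2"
      "x = a * c\<^sup>2 + b * s\<^sup>2" "z = a * s\<^sup>2 + b * c\<^sup>2"
      using G H[symmetric]
      unfolding rotated_diag_eq_sym2 sym2_inject c_def s_def u_def v_def by auto
    have "f\<^sup>2 + g\<^sup>2 = x * (c\<^sup>2 + s\<^sup>2)" "g\<^sup>2 + h\<^sup>2 = z * (c\<^sup>2 + s\<^sup>2)"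
      by (simp_all add: e ab algebra_simps power2_eq_square)
    then show "x = f\<^sup>2 + g\<^sup>2" "z = g\<^sup>2 + h\<^sup>2" by (simp_all add: cs)
  qed
  moreover obtain \<psi> m n where M: "sym2 f g h * sym2 k 0 1 * sym2 f g h = rotated_diag \<psi> m n"
    unfolding sym2_triple_product using sym2_diagonalization by metis
  ultimately have mn: "m + n = k * x + z" "m * n = k * (f * h - g\<^sup>2)\<^sup>2"
    using rotated_diag_trace_det[OF M[symmetric, unfolded sym2_triple_product]]
    by (simp_all add: algebra_simps power2_eq_square)
  have "0 \<le> m * n" unfolding mn using assms by simp
  moreover have "0 \<le> m + n" unfolding mn xyz using assms by simp
  ultimately have "0 \<le> m" "0 \<le> n" by (auto simp: zero_le_mult_iff)
  then have "m powr r \<le> (m + n) powr r" "n powr r \<le> (m + n) powr r"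
    using assms by (auto intro!: powr_mono2)
  then show ?thesis
    using \<open>mat_powr (sym2 x y z) (1/2) = sym2 f g h\<close>
    by (simp add: M mat_powr_def mat_fun_rotated_diag eigvals_desc_rotated_diag mn)
qed

text \<open>The test vector is the eigenvector of the second summand for \<open>a\<close>. There the
  second summand contributes exactly \<open>\<alpha> * a\<close>, and the first a nonnegative
  amount.\<close>

lemma eigval_exp_ge_rayleigh:
  assumes "0 \<le> u" "0 \<le> v" "0 \<le> \<beta>"
  shows "exp (\<alpha> * a) \<le> eigvals_desc (mat_exp (complex_of_real \<beta> \<cdot>\<^sub>m sym2 u 0 v
    + complex_of_real \<alpha> \<cdot>\<^sub>m rotated_diag \<theta> a b)) ! 0"
proof -
  define c s where "c = cos \<theta>" and "s = sin \<theta>"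
  have cs: "c\<^sup>2 + s\<^sup>2 = 1" by (simp add: c_def s_def)
  obtain x y z where R: "rotated_diag \<theta> a b = sym2 x y z" by (metis rotated_diag_eq_sym2)
  then have e: "x = a * c\<^sup>2 + b * s\<^sup>2" "y = (a - b) * (c * s)" "z = a * s\<^sup>2 + b * c\<^sup>2"
    unfolding rotated_diag_eq_sym2 sym2_inject c_def s_def by auto
  obtain \<omega> h k where H: "sym2 (\<beta> * u + \<alpha> * x) (\<alpha> * y) (\<beta> * v + \<alpha> * z) = rotated_diag \<omega> h k"
    using sym2_diagonalization by metis
  have "a = a * (c\<^sup>2 + s\<^sup>2)\<^sup>2" by (simp add: cs)
  also have "\<dots> = x * c\<^sup>2 + 2 * y * c * s + z * s\<^sup>2"
    by (simp add: e algebra_simps power2_eq_square)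
  finally have "\<alpha> * a \<le> \<alpha> * (x * c\<^sup>2 + 2 * y * c * s + z * s\<^sup>2) + \<beta> * (u * c\<^sup>2 + v * s\<^sup>2)"
    using assms by simp
  also have "\<dots> \<le> max h k"
    using rayleigh_le_max_eigval[OF H cs] by (simp add: algebra_simps)
  finally show ?thesis
    unfolding R sym2_linear_combination
    by (simp add: H mat_exp_def mat_fun_rotated_diag eigvals_desc_rotated_diag)
      (auto simp: le_max_iff_disj)
qed

section \<open>The counterexample\<close>

theorem theorem3p19:
  fixes \<alpha> p :: real
  assumes "1/2 < \<alpha>" and "\<alpha> < 1" and "0 < p"
  shows "\<exists>A \<in> pos_def_mats 2. \<exists>B \<in> pos_def_mats 2.
           \<not> log_maj 2 (LE_mean \<alpha> A B) (SG_tilde \<alpha> p A B)"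
proof -
  \<comment> \<open>With this choice
    \<open>(1 + \<delta>)^2 = 2 powr (2 * (1 - \<alpha>) / 3)\<close>, which stays below
    \<open>2 powr (1 - \<alpha>)\<close>; the left side of \<open>small\<close> will be the trace
    bound for SG.\<close>
  define \<delta> :: real where "\<delta> = 2 powr ((1 - \<alpha>) / 3) - 1"
  have \<delta>: "0 < \<delta>" using assms by (simp add: \<delta>_def gr_one_powr)
  have "2 powr ((1 - \<alpha>) / 3) < 2 powr (1::real)" using assms by (intro powr_less_mono) auto
  then have \<delta>1: "\<delta> < 1" by (simp add: \<delta>_def)
  have "(1 + \<delta>) * (1 + \<delta>) / 2 = 2 powr ((1 - \<alpha>) / 3 + (1 - \<alpha>) / 3 - 1)"
    by (simp add: \<delta>_def powr_diff flip: powr_add)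
  also have "\<dots> < 2 powr (- \<alpha>)" using assms by (intro powr_less_mono) (auto simp: field_simps)
  finally have small: "(1 + \<delta>) * (1 + \<delta>) / 2 < 2 powr (- \<alpha>)" .
  \<comment> \<open>The small eigenvalue of C, chosen so that its power \<open>\<alpha>\<close> is
    \<open>\<delta>\<close>.\<close>
  define \<epsilon> where "\<epsilon> = \<delta> powr (1 / \<alpha>)"
  have \<epsilon>: "0 < \<epsilon>" "\<epsilon> powr \<alpha> = \<delta>" using \<delta> assms by (simp_all add: \<epsilon>_def powr_powr)
  \<comment> \<open>Chosen so that \<open>diag(t^2, 1)\<close> to the power
    \<open>1 - 2 * \<alpha>\<close> is \<open>diag(\<delta>, 1)\<close>. The exponent is negative
    and \<open>\<delta> < 1\<close>, which forces \<open>1 \<le> t\<close> and so makes log A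
    nonnegative.\<close>
  define t where "t = \<delta> powr (1 / (2 * (1 - 2 * \<alpha>)))"
  have t: "0 < t" "t powr (2 * (1 - 2 * \<alpha>)) = \<delta>" using \<delta> assms by (simp_all add: t_def powr_powr)
  have t1: "1 \<le> t"
  proof (rule ccontr)
    assume "\<not> 1 \<le> t"
    then have "t powr 0 < t powr (2 * (1 - 2 * \<alpha>))"
      using t(1) assms by (intro powr_less_mono') auto
    then show False using t \<delta>1 by simp
  qed

  define A where "A = sym2 (t powr (2 / p)) 0 1"
  have C: "sym2 ((1 + e) / 2) ((1 - e) / 2) ((1 + e) / 2) = rotated_diag (pi / 4) 1 e" for e
    by (simp add: rotated_diag_eq_sym2 sym2_inject cos_45 sin_45 power_divide add_divide_distrib
      flip: power2_eq_square)
  \<comment> \<open>The entries of \<open>diag(1/t, 1) * C * diag(1/t, 1)\<close>, where C is the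
    matrix above with \<open>e = \<epsilon>\<close>. This will be the \<open>p\<close>-th power of
    \<open>B\<close>, just as \<open>diag(t^2, 1)\<close> is that of \<open>A\<close>.\<close>
  define x y z where "x = (1 + \<epsilon>) / 2 / t\<^sup>2" and "y = (1 - \<epsilon>) / 2 / t" and "z = (1 + \<epsilon>) / 2"
  obtain \<theta> b1 b2 where B0: "sym2 x y z = rotated_diag \<theta> b1 b2" "b2 \<le> b1"
    using sym2_diagonalization .
  have "x * z - y\<^sup>2 = \<epsilon> / t\<^sup>2"
    using t(1) by (simp add: x_def y_def z_def field_simps power2_eq_square)
  then have b: "0 < b1" "0 < b2"
    using rotated_diag_pos_eigvals[OF B0(1)[symmetric]] \<epsilon> t(1) by (auto simp: x_def z_def)
  \<comment> \<open>The second coordinate vector as test vector picks out the lower diagonal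
    entry.\<close>
  have "z \<le> b1"
    using rayleigh_le_max_eigval[OF B0(1), of 0 1] B0(2) by simp
  then have b1: "1 / 2 \<le> b1" using \<epsilon> by (simp add: z_def)
  define B where "B = rotated_diag \<theta> (b1 powr (1 / p)) (b2 powr (1 / p))"

  have pd: "A \<in> pos_def_mats 2" "B \<in> pos_def_mats 2"
    using t(1) b by (auto simp: A_def B_def sym2_diagonal intro!: rotated_diag_pos_def)

  \<comment> \<open>Lower bound for the largest eigenvalue of LE\<close>
  have "2 powr (- \<alpha>) = (1 / 2) powr \<alpha>"
    by (simp add: powr_minus_divide powr_divide)
  also have "\<dots> \<le> b1 powr \<alpha>" using b1 assms by (intro powr_mono2) auto
  finally have "2 powr (- \<alpha>) \<le> b1 powr \<alpha>" .
  then have "(2 powr (- \<alpha>)) powr (1 / p) \<le> (b1 powr \<alpha>) powr (1 / p)"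
    using assms by (intro powr_mono2) auto
  also have "\<dots> = exp (\<alpha> * ln (b1 powr (1 / p)))"
    using b by (simp add: powr_powr powr_def)
  also have "\<dots> \<le> eigvals_desc (LE_mean \<alpha> A B) ! 0"
    unfolding LE_mean_def mat_ln_def A_def B_def mat_fun_sym2_diagonal mat_fun_rotated_diag
    using assms t1 by (intro eigval_exp_ge_rayleigh) (auto simp: ge_one_powr_ge_zero)
  finally have LE: "(2 powr (- \<alpha>)) powr (1 / p) \<le> eigvals_desc (LE_mean \<alpha> A B) ! 0" .

  \<comment> \<open>Upper bound for the largest eigenvalue of SG\<close>
  define k where "k = t powr (4 * (1 - \<alpha>))"
  \<comment> \<open>The same entries with C replaced by its power \<open>\<alpha>\<close>, whose
    eigenvalues are 1 and \<open>\<delta>\<close>: conjugating by \<open>diag(t, 1)\<close> inside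
    the geometric mean recovers C.\<close>
  define x' y' z' where
    "x' = (1 + \<delta>) / 2 / t\<^sup>2" and "y' = (1 - \<delta>) / 2 / t" and "z' = (1 + \<delta>) / 2"
  have Ap: "mat_powr A (-p) = sym2 (1 / t\<^sup>2) 0 1"
    using assms t(1)
    by (simp add: A_def mat_powr_def mat_fun_sym2_diagonal powr_powr sym2_inject powr_minus_divide)
  have Bp: "mat_powr B p = sym2 x y z"
    using assms b by (simp add: B_def mat_powr_def mat_fun_rotated_diag powr_powr B0)
  have roots: "mat_powr (sym2 (1 / t\<^sup>2) 0 1) (1/2) = sym2 (1 / t) 0 1"
    "mat_powr (sym2 (1 / t\<^sup>2) 0 1) (-1/2) = sym2 t 0 1"
    using t(1)
    by (simp_all add: mat_powr_def mat_fun_sym2_diagonal sym2_inject powr_half_sqrt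
      powr_minus_divide real_sqrt_divide)
  have "sym2 t 0 1 * sym2 x y z * sym2 t 0 1 = rotated_diag (pi / 4) 1 \<epsilon>"
    unfolding sym2_triple_product C[symmetric]
    using t(1) by (simp add: sym2_inject x_def y_def z_def)
  then have "geo_mean \<alpha> (mat_powr A (-p)) (mat_powr B p)
      = sym2 (1 / t) 0 1 * rotated_diag (pi / 4) 1 \<delta> * sym2 (1 / t) 0 1"
    unfolding geo_mean_def Ap Bp roots
    by (simp add: mat_powr_def mat_fun_rotated_diag \<epsilon>)
  also have "\<dots> = sym2 x' y' z'"
    unfolding sym2_triple_product C[symmetric]
    by (simp add: sym2_inject x'_def y'_def z'_def power_divide)
  finally have G: "geo_mean \<alpha> (mat_powr A (-p)) (mat_powr B p) = sym2 x' y' z'" .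
  obtain \<phi> g1 g2 where G0: "sym2 x' y' z' = rotated_diag \<phi> g1 g2"
    using sym2_diagonalization .
  have "x' * z' - y'\<^sup>2 = \<delta> / t\<^sup>2"
    using t(1) by (simp add: x'_def y'_def z'_def field_simps power2_eq_square)
  then have g: "0 < g1" "0 < g2"
    using rotated_diag_pos_eigvals[OF G0[symmetric]] \<delta> t(1) by (auto simp: x'_def z'_def)
  have Ak: "mat_powr A (2 * (1 - \<alpha>) * p) = sym2 k 0 1"
    using assms
    by (simp add: A_def mat_powr_def mat_fun_sym2_diagonal powr_powr sym2_inject k_def)
  \<comment> \<open>The exponent is \<open>2 * (1 - 2 * \<alpha>)\<close>, so the choice of
    \<open>t\<close> applies. In the trace, the first diagonal entry then shrinks to
    \<open>\<delta>\<close> times the second.\<close>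
  have "k / t\<^sup>2 = t powr (4 * (1 - \<alpha>) - 2)"
    using t(1) unfolding k_def powr_diff by simp
  also have "\<dots> = \<delta>" unfolding t(2)[symmetric] by (simp add: algebra_simps)
  finally have "k = \<delta> * t\<^sup>2" using t(1) by (simp add: field_simps)
  then have "k * x' + z' = (1 + \<delta>) * (1 + \<delta>) / 2"
    using t(1) by (simp add: x'_def z'_def field_simps)
  moreover have "eigvals_desc (SG_tilde \<alpha> p A B) ! 0 \<le> (k * x' + z') powr (1 / p)"
    unfolding SG_tilde_def Let_def G Ak
    using eigval_powr_sandwich_le_trace[OF G0 g] assms by (simp add: k_def)
  moreover have "((1 + \<delta>) * (1 + \<delta>) / 2) powr (1 / p) < (2 powr (- \<alpha>)) powr (1 / p)"
    using small assms \<delta> by (intro powr_less_mono2) auto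
  ultimately have "eigvals_desc (SG_tilde \<alpha> p A B) ! 0 < eigvals_desc (LE_mean \<alpha> A B) ! 0"
    using LE by (metis le_less_trans less_le_trans)
  \<comment> \<open>Log-majorization already fails at \<open>k = 1\<close>, the comparison of
    largest eigenvalues.\<close>
  then have "\<not> log_maj 2 (LE_mean \<alpha> A B) (SG_tilde \<alpha> p A B)"
    unfolding log_maj_def by (auto intro!: bexI[of _ 1])
  with pd show ?thesis by blast
qed

end
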